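(* Let $G=(V,E)$ be a connected finite simple graph with $n=|V|$, let $k$ be the largest cardinality of an independent set of $G$, and let $\mathcal G$ be the graph constructed from $G$ as described in the context. Then the largest proper stalled subset of the vertex set of $\mathcal G$ has cardinality $(2n+1)|E|+k$, and the largest proper skew stalled subset of the vertex set of $\mathcal G$ also has cardinality $(2n+1)|E|+k$.
   Context: For a finite simple graph $H$ with vertex set $W$ and a set $F\subseteq W$: an empty vertex $v\in W\setminus F$ is forced by $F$ if there is $u\in F$ such that $v$ is the unique neighbor of $u$ outside $F$; it is skew forced by $F$ if there is $u\in W$ (not necessarily in $F$) such that $v$ is the unique neighbor of $u$ outside $F$. $F$ is stalled (resp. skew stalled) if no vertex of $W\setminus F$ is forced (resp. skew forced) by $F$. $F$ is proper if $F\neq W$. Construction of $\mathcal G$: given $G=(V,E)$ with $n=|V|$, let $E^i=\{e^i : e\in E\}$ for $i=0,1,\dots,2n$ be $2n+1$ pairwise disjoint copies of $E$ (disjoint from $V$), and let $\varepsilon$ be a further new vertex. The vertex set of $\mathcal G$ is $\mathcal V=V\cup E^0\cup\dots\cup E^{2n}\cup\{\varepsilon\}$ (so $|\mathcal V|=(2n+1)|E|+n+1$). The edges of $\mathcal G$ are exactly: for every edge $e=\{u,v\}\in E$, the edges $\{u,e^0\}$ and $\{e^0,v\}$; the edges $\{e^i,e^{i+1}\}$ for $0\le i\le 2n-1$; and the edge $\{\varepsilon,e^0\}$. *)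

theory Defs
  imports Main
begin

definition simple_graph :: "'a set \<Rightarrow> 'a set set \<Rightarrow> bool" where
  "simple_graph W D \<longleftrightarrow> finite W \<and> (\<forall>e\<in>D. e \<subseteq> W \<and> card e = 2)"

definition connected_graph :: "'a set \<Rightarrow> 'a set set \<Rightarrow> bool" where
  "connected_graph W D \<longleftrightarrow> (\<forall>u\<in>W. \<forall>v\<in>W. (u, v) \<in> {(x, y). {x, y} \<in> D}\<^sup>*)"

definition independent_set :: "'a set \<Rightarrow> 'a set set \<Rightarrow> 'a set \<Rightarrow> bool" where
  "independent_set W D I \<longleftrightarrow> I \<subseteq> W \<and> (\<forall>u\<in>I. \<forall>v\<in>I. {u, v} \<notin> D)"

definition nbhd :: "'a set \<Rightarrow> 'a set set \<Rightarrow> 'a \<Rightarrow> 'a set" where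
  "nbhd W D u = {v \<in> W. {u, v} \<in> D}"

definition forced :: "'a set \<Rightarrow> 'a set set \<Rightarrow> 'a set \<Rightarrow> 'a \<Rightarrow> bool" where
  "forced W D F v \<longleftrightarrow> v \<in> W - F \<and> (\<exists>u\<in>F. nbhd W D u - F = {v})"

definition skew_forced :: "'a set \<Rightarrow> 'a set set \<Rightarrow> 'a set \<Rightarrow> 'a \<Rightarrow> bool" where
  "skew_forced W D F v \<longleftrightarrow> v \<in> W - F \<and> (\<exists>u\<in>W. nbhd W D u - F = {v})"

definition stalled :: "'a set \<Rightarrow> 'a set set \<Rightarrow> 'a set \<Rightarrow> bool" where
  "stalled W D F \<longleftrightarrow> F \<subseteq> W \<and> (\<forall>v\<in>W - F. \<not> forced W D F v)"

definition skew_stalled :: "'a set \<Rightarrow> 'a set set \<Rightarrow> 'a set \<Rightarrow> bool" where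
  "skew_stalled W D F \<longleftrightarrow> F \<subseteq> W \<and> (\<forall>v\<in>W - F. \<not> skew_forced W D F v)"

(* The maximum is required to be attained; unlike Max, this asserts something
   even when no set satisfies P. *)
definition is_largest_card :: "('a set \<Rightarrow> bool) \<Rightarrow> nat \<Rightarrow> bool" where
  "is_largest_card P k \<longleftrightarrow> (\<exists>F. P F \<and> card F = k) \<and> (\<forall>F. P F \<longrightarrow> card F \<le> k)"

(* Copy e i is the i-th copy of the edge e. *)
datatype 'a gadget_vertex = Orig 'a | Copy "'a set" nat | Eps

definition gadget_verts :: "'a set \<Rightarrow> 'a set set \<Rightarrow> 'a gadget_vertex set" where
  "gadget_verts V E =
     Orig ` V \<union> {Copy e i | e i. e \<in> E \<and> i \<le> 2 * card V} \<union> {Eps}"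

definition gadget_edges :: "'a set \<Rightarrow> 'a set set \<Rightarrow> 'a gadget_vertex set set" where
  "gadget_edges V E =
     {{Orig u, Copy e 0} | u e. e \<in> E \<and> u \<in> e} \<union>
     {{Copy e i, Copy e (i + 1)} | e i. e \<in> E \<and> i < 2 * card V} \<union>
     {{Eps, Copy e 0} | e. e \<in> E}"

lemma simple_graph_gadget:
  assumes "simple_graph V E"
  shows "simple_graph (gadget_verts V E) (gadget_edges V E)"
proof -
  have fV: "finite V" and sub: "\<And>e. e \<in> E \<Longrightarrow> e \<subseteq> V"
    using assms by (auto simp: simple_graph_def)
  have fE: "finite E"
    by (rule finite_subset[of _ "Pow V"]) (use sub fV in auto)
  have "{Copy e i | e i. e \<in> E \<and> i \<le> 2 * card V}
          = (\<lambda>(e, i). Copy e i) ` (E \<times> {..2 * card V})"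
    by auto
  then have "finite (gadget_verts V E)"
    using fV fE by (simp add: gadget_verts_def)
  moreover have "\<forall>d\<in>gadget_edges V E. d \<subseteq> gadget_verts V E \<and> card d = 2"
    using sub by (fastforce simp: gadget_edges_def gadget_verts_def)
  ultimately show ?thesis
    by (simp add: simple_graph_def)
qed

lemma card_gadget_verts:
  assumes "simple_graph V E"
  shows "card (gadget_verts V E) = (2 * card V + 1) * card E + card V + 1"
proof -
  have fV: "finite V" and sub: "\<And>e. e \<in> E \<Longrightarrow> e \<subseteq> V"
    using assms by (auto simp: simple_graph_def)
  have fE: "finite E"
    by (rule finite_subset[of _ "Pow V"]) (use sub fV in auto)
  let ?C = "(\<lambda>(e, i). Copy e i) ` (E \<times> {..2 * card V})"
  have eq: "gadget_verts V E = insert Eps (Orig ` V \<union> ?C)"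
    by (auto simp: gadget_verts_def)
  have "card ?C = card (E \<times> {..2 * card V})"
    by (rule card_image) (auto simp: inj_on_def)
  moreover have "card (Orig ` V) = card V"
    by (rule card_image) (auto simp: inj_on_def)
  moreover have "card (Orig ` V \<union> ?C) = card (Orig ` V) + card ?C"
    by (rule card_Un_disjoint) (use fV fE in auto)
  moreover have "Eps \<notin> Orig ` V \<union> ?C"
    by auto
  ultimately show ?thesis
    unfolding eq using fV fE by (simp add: card_cartesian_product algebra_simps)
qed

end

(* Stalled sets are read off complements: F is stalled iff no filled vertex has exactly one empty
   neighbour. If some vertex of the path e^0, ..., e^{2n} is empty, then no two consecutive vertices
   of that path are filled and its end e^{2n} is empty, so at least n + 1 vertices are empty and F
   is small enough. If all copies are filled, each e^0 sees its two endpoints and Eps: with Eps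
   empty the filled original vertices are independent, and with Eps filled connectivity makes all
   original vertices empty. Conversely, all copies together with a maximum independent set of G
   form a skew stalled set. *)
theory Submission imports Defs begin

text \<open>\<open>nbhd\<close> lies inside \<open>W\<close>, so a unique empty neighbour is
  automatically in \<open>W - F\<close> and \<open>v\<close> may range over the whole type.\<close>

lemma stalled_iff:
  "stalled W D F \<longleftrightarrow> F \<subseteq> W \<and> (\<forall>u\<in>F. \<forall>v. nbhd W D u - F \<noteq> {v})"
  unfolding stalled_def forced_def nbhd_def by blast

lemma skew_stalled_iff:
  "skew_stalled W D F \<longleftrightarrow> F \<subseteq> W \<and> (\<forall>u\<in>W. \<forall>v. nbhd W D u - F \<noteq> {v})"
  unfolding skew_stalled_def skew_forced_def nbhd_def by blast

lemma skew_stalled_imp_stalled: "skew_stalled W D F \<Longrightarrow> stalled W D F"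
  unfolding stalled_iff skew_stalled_iff by blast

lemma nbhd_Orig:
  assumes "\<And>e. e \<in> E \<Longrightarrow> e \<subseteq> V"
  shows "nbhd (gadget_verts V E) (gadget_edges V E) (Orig u) = {Copy e 0 | e. e \<in> E \<and> u \<in> e}"
  using assms by (auto simp: nbhd_def gadget_verts_def gadget_edges_def doubleton_eq_iff)

lemma nbhd_Eps: "nbhd (gadget_verts V E) (gadget_edges V E) Eps = {Copy e 0 | e. e \<in> E}"
  by (auto simp: nbhd_def gadget_verts_def gadget_edges_def doubleton_eq_iff)

text \<open>Positivity of \<open>card V\<close> ensures that the path goes beyond e^0, so that e^1
  is a vertex.\<close>

lemma nbhd_Copy_0:
  assumes "e \<in> E" "e \<subseteq> V" "0 < card V"
  shows "nbhd (gadget_verts V E) (gadget_edges V E) (Copy e 0) =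
    insert Eps (insert (Copy e 1) (Orig ` e))"
  using assms by (auto simp: nbhd_def gadget_verts_def gadget_edges_def doubleton_eq_iff)

lemma nbhd_Copy_Suc:
  assumes "e \<in> E" "Suc i \<le> 2 * card V"
  shows "nbhd (gadget_verts V E) (gadget_edges V E) (Copy e (Suc i)) =
    insert (Copy e i) (if Suc i < 2 * card V then {Copy e (Suc (Suc i))} else {})"
  using assms by (auto simp: nbhd_def gadget_verts_def gadget_edges_def doubleton_eq_iff)
    (rule exI[of _ e], rule exI[of _ i], simp)+

text \<open>By \<open>step\<close>, two adjacent positions satisfying P pass this on to the next
  adjacent pair on either side, so P spreads both ways.\<close>

lemma consecutive_propagate:
  fixes P :: "nat \<Rightarrow> bool"
  assumes step: "\<And>j. Suc (Suc j) \<le> m \<Longrightarrow> P (Suc j) \<Longrightarrow> P j \<longleftrightarrow> P (Suc (Suc j))"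
    and "Suc i \<le> m" "P i" "P (Suc i)" "j \<le> m"
  shows "P j"
proof -
  \<comment> \<open>Comparing every pair with the one at 0 lets a single upward induction cover both
    directions: from i down to 0, then up to j.\<close>
  have eq: "Suc j \<le> m \<Longrightarrow> P j \<and> P (Suc j) \<longleftrightarrow> P 0 \<and> P (Suc 0)" for j
  proof (induction j)
    case (Suc j)
    then show ?case using step[of j] by auto
  qed simp
  have *: "P 0 \<and> P (Suc 0)" using eq[of i] assms by blast
  show ?thesis
  proof (cases j)
    case (Suc l)
    then show ?thesis using eq[of l] * \<open>j \<le> m\<close> by simp
  qed (use * in simp)
qed

lemma card_all_copies_filled:
  assumes "simple_graph V E"
    and copies: "\<And>e i. e \<in> E \<Longrightarrow> i \<le> 2 * card V \<Longrightarrow> Copy e i \<in> F"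
    and "F \<subseteq> gadget_verts V E"
  shows "card F = (2 * card V + 1) * card E + card {v \<in> V. Orig v \<in> F} + (if Eps \<in> F then 1 else 0)"
proof -
  have fV: "finite V" and fE: "finite E"
    using assms(1) finite_subset[of E "Pow V"] by (auto simp: simple_graph_def)
  let ?C = "(\<lambda>(e, i). Copy e i) ` (E \<times> {..2 * card V}) :: 'a gadget_vertex set"
  let ?O = "Orig ` {v \<in> V. Orig v \<in> F}"
  have F: "F = ?C \<union> ?O \<union> (if Eps \<in> F then {Eps} else {})"
    using assms(3) copies by (auto simp: gadget_verts_def)
  have C: "card ?C = (2 * card V + 1) * card E"
    by (subst card_image) (auto simp: inj_on_def card_cartesian_product)
  have O: "card ?O = card {v \<in> V. Orig v \<in> F}"
    by (rule card_image) (auto simp: inj_on_def)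
  have "card (?C \<union> ?O) = card ?C + card ?O"
    by (rule card_Un_disjoint) (use fV fE in auto)
  moreover have "card (?C \<union> ?O \<union> (if Eps \<in> F then {Eps} else {})) =
      card (?C \<union> ?O) + card (if Eps \<in> F then {Eps} else {} :: 'a gadget_vertex set)"
    by (rule card_Un_disjoint) (use fV fE in auto)
  ultimately show ?thesis
    using C O by (subst F) simp
qed

text \<open>This is what the length of the paths is for: n + 1 empty vertices on one path offset the
  n + 1 vertices of the gadget that are not copies.\<close>

lemma card_stalled_empty_copy:
  assumes "simple_graph V E" and st: "stalled (gadget_verts V E) (gadget_edges V E) F"
    and e: "e \<in> E" and i: "i \<le> 2 * card V" and empty: "Copy e i \<notin> F"
  shows "card F \<le> (2 * card V + 1) * card E"
proof -
  let ?W = "gadget_verts V E" and ?n = "card V"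
  have fW: "finite ?W"
    using simple_graph_gadget[OF assms(1)] by (simp add: simple_graph_def)
  have "finite V" "e \<subseteq> V" "e \<noteq> {}"
    using assms(1) e by (force simp: simple_graph_def)+
  then have n: "0 < ?n" by (auto simp: card_gt_0_iff)
  have FW: "F \<subseteq> ?W" and st': "\<And>u v. u \<in> F \<Longrightarrow> nbhd ?W (gadget_edges V E) u - F \<noteq> {v}"
    using st by (auto simp: stalled_iff)
  \<comment> \<open>Away from e^0 and the far end, a filled path vertex has exactly two neighbours,
    so stalling makes them both filled or both empty.\<close>
  have step: "Copy e j \<in> F \<longleftrightarrow> Copy e (Suc (Suc j)) \<in> F"
    if "Suc (Suc j) \<le> 2 * ?n" "Copy e (Suc j) \<in> F" for j
    using st'[OF that(2), of "Copy e j"] st'[OF that(2), of "Copy e (Suc (Suc j))"]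
      nbhd_Copy_Suc[OF e, of j V] that(1) by auto
  have pair: "Copy e j \<notin> F \<or> Copy e (Suc j) \<notin> F" if "Suc j \<le> 2 * ?n" for j
    using consecutive_propagate[of "2 * ?n" "\<lambda>j. Copy e j \<in> F" j i] step that i empty by blast
  have last: "Copy e (2 * ?n) \<notin> F"
  proof
    assume last: "Copy e (2 * ?n) \<in> F"
    obtain l where l: "2 * ?n = Suc l" using n by (cases "2 * ?n") auto
    then have "Copy e l \<notin> F" using pair[of l] last by auto
    then show False
      using st'[OF last, of "Copy e l"] nbhd_Copy_Suc[OF e, of l V] l by auto
  qed
  \<comment> \<open>f picks an empty vertex from each block {2j, 2j + 1}; disjoint blocks make it
    injective. The block for j = n has only 2n on the path, and \<open>last\<close> makes f choose
    it.\<close>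
  define f where "f j = Copy e (if Copy e (2 * j) \<in> F then Suc (2 * j) else 2 * j)" for j
  have "inj f"
  proof (rule injI)
    fix j l assume "f j = f l"
    then have "Suc (2 * j) = Suc (2 * l) \<or> Suc (2 * j) = 2 * l \<or> 2 * j = Suc (2 * l) \<or> 2 * j = 2 * l"
      by (simp add: f_def split: if_splits)
    then show "j = l" by presburger
  qed
  moreover have "f j \<in> ?W - F" if "j \<le> ?n" for j
  proof (cases "j = ?n")
    case True
    then show ?thesis using last e by (auto simp: f_def gadget_verts_def)
  next
    case False
    then show ?thesis using that pair[of "2 * j"] e by (auto simp: f_def gadget_verts_def)
  qed
  ultimately have "card {..?n} \<le> card (?W - F)"
    by (intro card_inj_on_le[of f]) (auto simp: fW inj_on_def)
  then have "?n + 1 \<le> card ?W - card F"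
    using FW fW by (simp add: card_Diff_subset finite_subset)
  then show ?thesis using card_gadget_verts[OF assms(1)] by simp
qed

lemma card_stalled_le:
  assumes sg: "simple_graph V E" and conn: "connected_graph V E"
    and k: "\<And>I. independent_set V E I \<Longrightarrow> card I \<le> k"
    and proper: "F \<noteq> gadget_verts V E" and st: "stalled (gadget_verts V E) (gadget_edges V E) F"
  shows "card F \<le> (2 * card V + 1) * card E + k"
proof (cases "\<exists>e\<in>E. \<exists>i\<le>2 * card V. Copy e i \<notin> F")
  case True
  then show ?thesis using card_stalled_empty_copy[OF sg st] by fastforce
next
  case False
  then have copies: "\<And>e i. e \<in> E \<Longrightarrow> i \<le> 2 * card V \<Longrightarrow> Copy e i \<in> F" by blast
  let ?W = "gadget_verts V E" and ?I = "{v \<in> V. Orig v \<in> F}"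
  have FW: "F \<subseteq> ?W" and st': "\<And>u v. u \<in> F \<Longrightarrow> nbhd ?W (gadget_edges V E) u - F \<noteq> {v}"
    using st by (auto simp: stalled_iff)
  note cardF = card_all_copies_filled[OF sg copies FW]
  have sub: "e \<subseteq> V" "card e = 2" if "e \<in> E" for e
    using sg that by (auto simp: simple_graph_def)
  have centre: "insert Eps (Orig ` e) - F \<noteq> {v}" if e: "e \<in> E" for e v
  proof -
    have "e \<noteq> {}" "finite V" using sub[OF e] sg by (auto simp: simple_graph_def)
    then have n: "0 < card V" using sub(1)[OF e] by (auto simp: card_gt_0_iff)
    then have "Copy e 0 \<in> F" "Copy e 1 \<in> F" using copies[OF e] by auto
    then show ?thesis
      using st'[of "Copy e 0" v] nbhd_Copy_0[OF e sub(1)[OF e] n] by auto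
  qed
  show ?thesis
  proof (cases "Eps \<in> F")
    case False
    have "independent_set V E ?I"
      unfolding independent_set_def
    proof (intro conjI ballI notI)
      \<comment> \<open>With both ends of an edge filled, \<open>Eps\<close> would be the only empty
        neighbour of its e^0.\<close>
      fix u v assume "u \<in> ?I" "v \<in> ?I" "{u, v} \<in> E"
      then show False using centre[of "{u, v}" Eps] False by auto
    qed auto
    then show ?thesis using k[of ?I] cardF False by simp
  next
    case True
    have adj: "Orig u \<in> F \<longleftrightarrow> Orig v \<in> F" if "{u, v} \<in> E" for u v
      using centre[OF that, of "Orig u"] centre[OF that, of "Orig v"] True by auto
    have reach: "Orig u \<in> F \<longleftrightarrow> Orig v \<in> F" if "(u, v) \<in> {(x, y). {x, y} \<in> E}\<^sup>*" for u v
      using that by (induction rule: rtrancl_induct) (auto dest: adj)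
    \<comment> \<open>Properness enters here: with \<open>Eps\<close> and all copies filled, only an
      original vertex can be empty.\<close>
    obtain w where w: "w \<in> V" "Orig w \<notin> F"
      using proper FW copies True by (auto simp: gadget_verts_def)
    have "?I = {}"
      using reach conn w unfolding connected_graph_def by blast
    \<comment> \<open>A single vertex is independent, so k is at least 1, which absorbs the 1 that
      \<open>Eps\<close> adds to the count.\<close>
    moreover have "independent_set V E {w}"
      using w sub(2)[of "{w}"] by (auto simp: independent_set_def)
    ultimately show ?thesis using k[of "{w}"] cardF by (simp only: card.empty) simp
  qed
qed

text \<open>Only the vertices e^0 have empty neighbours, and each has at least two:
  \<open>Eps\<close> and an endpoint of e outside I.\<close>

lemma independent_skew_stalled:
  assumes sg: "simple_graph V E" and I: "independent_set V E I"
  defines "F \<equiv> Orig ` I \<union> {Copy e i | e i. e \<in> E \<and> i \<le> 2 * card V}"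
  shows "skew_stalled (gadget_verts V E) (gadget_edges V E) F"
    and "F \<noteq> gadget_verts V E"
    and "card F = (2 * card V + 1) * card E + card I"
proof -
  let ?W = "gadget_verts V E" and ?D = "gadget_edges V E"
  have IV: "I \<subseteq> V" using I by (simp add: independent_set_def)
  then have FW: "F \<subseteq> ?W" by (auto simp: F_def gadget_verts_def)
  have sub: "e \<subseteq> V" "card e = 2" if "e \<in> E" for e
    using sg that by (auto simp: simple_graph_def)
  have "nbhd ?W ?D u - F \<noteq> {v}" if u: "u \<in> ?W" for u v
  proof (cases u)
    case (Orig x)
    have "nbhd ?W ?D u \<subseteq> F" using nbhd_Orig[of E V x] sub(1) Orig by (auto simp: F_def)
    then show ?thesis by blast
  next
    case Eps
    have "nbhd ?W ?D u \<subseteq> F" using nbhd_Eps[of V E] Eps by (auto simp: F_def)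
    then show ?thesis by blast
  next
    case (Copy e i)
    have e: "e \<in> E" "i \<le> 2 * card V" using u Copy by (auto simp: gadget_verts_def)
    show ?thesis
    proof (cases i)
      case (Suc j)
      then have "nbhd ?W ?D u \<subseteq> F"
        using nbhd_Copy_Suc[OF e(1), of j V] e Copy by (auto simp: F_def)
      then show ?thesis by blast
    next
      case 0
      obtain a b where ab: "e = {a, b}" using sub(2)[OF e(1)] by (auto simp: card_2_iff)
      then have "0 < card V"
        using sub(1)[OF e(1)] sg by (auto simp: simple_graph_def card_gt_0_iff)
      then have "insert Eps (Orig ` e) \<subseteq> nbhd ?W ?D u"
        using nbhd_Copy_0[OF e(1) sub(1)[OF e(1)]] 0 Copy by auto
      moreover have "a \<notin> I \<or> b \<notin> I"
        using I e ab by (auto simp: independent_set_def)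
      moreover have "Eps \<notin> F" "\<And>x. Orig x \<in> F \<longleftrightarrow> x \<in> I" by (auto simp: F_def)
      ultimately have "Eps \<in> nbhd ?W ?D u - F" "\<exists>x. Orig x \<in> nbhd ?W ?D u - F"
        using ab by auto
      then show ?thesis by (metis gadget_vertex.distinct(3) singletonD)
    qed
  qed
  then show "skew_stalled ?W ?D F" using FW by (auto simp: skew_stalled_iff)
  have "Eps \<notin> F" by (auto simp: F_def)
  then show "F \<noteq> ?W" by (auto simp: gadget_verts_def)
  have "{v \<in> V. Orig v \<in> F} = I" using IV by (auto simp: F_def)
  moreover have "Copy e i \<in> F" if "e \<in> E" "i \<le> 2 * card V" for e i
    using that by (auto simp: F_def)
  ultimately show "card F = (2 * card V + 1) * card E + card I"
    using card_all_copies_filled[OF sg _ FW] \<open>Eps \<notin> F\<close> by simp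
qed

theorem theorem1:
  fixes V :: "'a set" and E :: "'a set set" and n k :: nat
  assumes "simple_graph V E"
    and "connected_graph V E"
    and "n = card V"
    and "is_largest_card (independent_set V E) k"
  shows "is_largest_card
           (\<lambda>F. F \<noteq> gadget_verts V E \<and> stalled (gadget_verts V E) (gadget_edges V E) F)
           ((2 * n + 1) * card E + k) \<and>
         is_largest_card
           (\<lambda>F. F \<noteq> gadget_verts V E \<and> skew_stalled (gadget_verts V E) (gadget_edges V E) F)
           ((2 * n + 1) * card E + k)"
proof -
  obtain I where I: "independent_set V E I" "card I = k"
    and k: "\<And>J. independent_set V E J \<Longrightarrow> card J \<le> k"
    using assms(4) by (auto simp: is_largest_card_def)
  note lower = independent_skew_stalled[OF assms(1) I(1)]
  have upper: "card F \<le> (2 * card V + 1) * card E + k"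
    if "F \<noteq> gadget_verts V E" "stalled (gadget_verts V E) (gadget_edges V E) F" for F
    using card_stalled_le[OF assms(1,2) k that] by simp
  \<comment> \<open>Both maxima are instances: skew stalled sets are stalled, so they inherit the
    upper bound, and one extremal set attains it for both notions.\<close>
  have largest: "is_largest_card P ((2 * card V + 1) * card E + k)"
    if sub: "\<And>F. P F \<Longrightarrow> F \<noteq> gadget_verts V E \<and> stalled (gadget_verts V E) (gadget_edges V E) F"
      and ex: "P (Orig ` I \<union> {Copy e i | e i. e \<in> E \<and> i \<le> 2 * card V})" for P
    unfolding is_largest_card_def
  proof (intro conjI allI impI exI)
    show "card F \<le> (2 * card V + 1) * card E + k" if "P F" for F
      using upper sub[OF that] by blast
  qed (fact ex, use lower(3) I(2) in blast)
  show ?thesis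
    unfolding \<open>n = card V\<close>
    by (intro conjI; rule largest)
      (use lower(1,2) skew_stalled_imp_stalled in blast)+
qed

end
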